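(* Let $A$ and $B$ be unital C*-algebras. A unital $\ast$-homomorphism $f:A\to B$ induces a continuous map of locales $\underline{\Sigma}(\underline{f}):F^{\sharp}\underline{\Sigma}_{\underline{B}}\to\underline{\Sigma}_{\underline{A}}$ in $[\mathcal{C}_{A},\mathbf{Set}]$, whose external description is the continuous function over $\mathcal{C}_A^{\uparrow}$ $$\Sigma(\underline{f}):\hat{f}^{\ast}\Sigma^{\uparrow}_{\underline{B}}\to\Sigma^{\uparrow}_{\underline{A}},\qquad (C,\lambda)\mapsto(C,\lambda\circ f|_{C}).$$ If $f$ reflects commutativity, then there is also a locale map $\underline{\Sigma}(\underline{g}):\underline{\Sigma}_{\underline{B}}\to G^{\sharp}\underline{\Sigma}_{\underline{A}}$ in $[\mathcal{C}_{B},\mathbf{Set}]$, externally given by the continuous function over $\mathcal{C}_B^{\uparrow}$ $$\Sigma(\underline{g}):\Sigma^{\uparrow}_{\underline{B}}\to\hat{g}^{\ast}\Sigma^{\uparrow}_{\underline{A}},\qquad (D,\lambda)\mapsto(D,\lambda\circ f|_{f^{-1}(D)}).$$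
   Context: For a unital C*-algebra $A$, $\mathcal{C}_A$ is the poset (under inclusion) of commutative unital C*-subalgebras of $A$ (containing the unit of $A$), and $\mathcal{C}_A^{\uparrow}$ is $\mathcal{C}_A$ with the Alexandroff topology of upward closed subsets; $[\mathcal{C}_A,\mathbf{Set}]\cong Sh(\mathcal{C}_A^{\uparrow})$. $\Sigma_C$ is the Gelfand spectrum of $C\in\mathcal{C}_A$ and $\rho_{CD}:\Sigma_C\to\Sigma_D$ is restriction for $D\subseteq C$. Locales internal to $Sh(X)$ are identified with locales over $X$ (equivalence $\mathbf{Loc}_{Sh(X)}\simeq\mathbf{Loc}/X$). $\underline{A}$ is the internal commutative C*-algebra $C\mapsto C$ (with inclusions) in $[\mathcal{C}_A,\mathbf{Set}]$, and its internal Gelfand spectrum $\underline{\Sigma}_{\underline{A}}$ is externally the bundle $\pi_A:\Sigma^{\uparrow}_{\underline{A}}\to\mathcal{C}_A^{\uparrow}$, $(C,\lambda)\mapsto C$, where $\Sigma^{\uparrow}_{\underline{A}}=\coprod_{C\in\mathcal{C}_A}\Sigma_C$ and $U$ is open iff (1) $U_C:=U\cap\Sigma_C$ is open in $\Sigma_C$ for every $C$, and (2) $\rho_{CD}^{-1}(U_D)\subseteq U_C$ whenever $D\subseteq C$. Similarly for $B$. $f$ reflects commutativity if $[f(a_1),f(a_2)]=0$ implies $[a_1,a_2]=0$ for all $a_1,a_2\in A$. Define $\hat{f}:\mathcal{C}_A\to\mathcal{C}_B$, $\hat f(C)=f[C]$, and, if $f$ reflects commutativity, $\hat{g}:\mathcal{C}_B\to\mathcal{C}_A$,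 $\hat{g}(D)=f^{-1}(D)$. These are Alexandroff-continuous and induce geometric morphisms $F:[\mathcal{C}_A,\mathbf{Set}]\to[\mathcal{C}_B,\mathbf{Set}]$ and $G:[\mathcal{C}_B,\mathbf{Set}]\to[\mathcal{C}_A,\mathbf{Set}]$. $F^{\sharp}$ (resp. $G^{\sharp}$) sends an internal locale, viewed as a bundle, to its pullback along $\hat{f}$ (resp. $\hat{g}$). Explicitly, $F^{\sharp}\underline{\Sigma}_{\underline{B}}$ is externally the bundle $\hat{f}^{\ast}\Sigma^{\uparrow}_{\underline{B}}=\coprod_{C\in\mathcal{C}_A}\Sigma_{f[C]}\to\mathcal{C}_A^{\uparrow}$, $(C,\lambda)\mapsto C$, with $U$ open iff $U_C:=U\cap\Sigma_{f[C]}$ is open in $\Sigma_{f[C]}$ for each $C\in\mathcal{C}_A$, and $\rho_{f[C_2]f[C_1]}^{-1}(U_{C_1})\subseteq U_{C_2}$ for $C_1\subseteq C_2$. And $G^{\sharp}\underline{\Sigma}_{\underline{A}}$ is externally $\hat{g}^{\ast}\Sigma^{\uparrow}_{\underline{A}}=\coprod_{D\in\mathcal{C}_B}\Sigma_{f^{-1}(D)}\to\mathcal{C}_B^{\uparrow}$, with $U$ open iff $U_D:=U\cap\Sigma_{f^{-1}(D)}$ is open in $\Sigma_{f^{-1}(D)}$ for each $D\in\mathcal{C}_B$, and $\rho_{f^{-1}(D_2)f^{-1}(D_1)}^{-1}(U_{D_1})\subseteq U_{D_2}$ for $D_1\subseteq D_2$. *)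

theory Defs
  imports "HOL-Analysis.Analysis"
begin

section \<open>Unital C*-algebras\<close>

text \<open>The class is built over \<^class>\<open>monoid_mult\<close> rather than \<^class>\<open>real_normed_algebra_1\<close>,
  because the latter demands \<open>0 \<noteq> 1\<close> and would exclude the zero algebra.\<close>

class unital_cstar_algebra = real_normed_algebra + banach + monoid_mult +
  fixes scaleC :: "complex \<Rightarrow> 'a \<Rightarrow> 'a"
    and star :: "'a \<Rightarrow> 'a"
  assumes scaleC_add_right: "scaleC c (x + y) = scaleC c x + scaleC c y"
    and scaleC_add_left: "scaleC (c + d) x = scaleC c x + scaleC d x"
    and scaleC_scaleC: "scaleC c (scaleC d x) = scaleC (c * d) x"
    and scaleC_of_real: "scaleC (complex_of_real r) x = scaleR r x"
    and mult_scaleC_left: "scaleC c x * y = scaleC c (x * y)"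
    and mult_scaleC_right: "x * scaleC c y = scaleC c (x * y)"
    and norm_scaleC: "norm (scaleC c x) = cmod c * norm x"
    and star_add: "star (x + y) = star x + star y"
    and star_scaleC: "star (scaleC c x) = scaleC (cnj c) (star x)"
    and star_mult: "star (x * y) = star y * star x"
    and star_star: "star (star x) = x"
    and cstar_identity: "norm (star x * x) = (norm x)\<^sup>2"

definition unital_star_hom ::
    "('a::unital_cstar_algebra \<Rightarrow> 'b::unital_cstar_algebra) \<Rightarrow> bool" where
  "unital_star_hom f \<longleftrightarrow>
     (\<forall>x y. f (x + y) = f x + f y) \<and>
     (\<forall>c x. f (scaleC c x) = scaleC c (f x)) \<and>
     (\<forall>x y. f (x * y) = f x * f y) \<and>
     (\<forall>x. f (star x) = star (f x)) \<and>
     f 1 = 1"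

definition commutator :: "'a::unital_cstar_algebra \<Rightarrow> 'a \<Rightarrow> 'a" where
  "commutator x y = x * y - y * x"

definition reflects_commutativity ::
    "('a::unital_cstar_algebra \<Rightarrow> 'b::unital_cstar_algebra) \<Rightarrow> bool" where
  "reflects_commutativity f \<longleftrightarrow>
     (\<forall>x y. commutator (f x) (f y) = 0 \<longrightarrow> commutator x y = 0)"

text \<open>The poset of commutative unital C*-subalgebras; its order is inclusion of sets.\<close>

definition comm_subalgebras :: "'a::unital_cstar_algebra set set" where
  "comm_subalgebras = {C. closed C \<and> 1 \<in> C \<and>
     (\<forall>x\<in>C. \<forall>y\<in>C. x + y \<in> C) \<and>
     (\<forall>c. \<forall>x\<in>C. scaleC c x \<in> C) \<and>
     (\<forall>x\<in>C. \<forall>y\<in>C. x * y \<in> C) \<and>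
     (\<forall>x\<in>C. star x \<in> C) \<and>
     (\<forall>x\<in>C. \<forall>y\<in>C. x * y = y * x)}"


section \<open>Gelfand spectra\<close>

text \<open>A functional on \<open>C\<close> is represented by the extensional function that is
  \<^const>\<open>undefined\<close> outside \<open>C\<close>, so that equality of characters is equality on \<open>C\<close>, and
  restriction of characters is \<^const>\<open>restrict\<close>.\<close>

definition characters :: "'a::unital_cstar_algebra set \<Rightarrow> ('a \<Rightarrow> complex) set" where
  "characters C = {\<omega> \<in> extensional C.
     (\<forall>x\<in>C. \<forall>y\<in>C. \<omega> (x + y) = \<omega> x + \<omega> y) \<and>
     (\<forall>c. \<forall>x\<in>C. \<omega> (scaleC c x) = c * \<omega> x) \<and>
     (\<forall>x\<in>C. \<forall>y\<in>C. \<omega> (x * y) = \<omega> x * \<omega> y) \<and>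
     \<omega> 1 = 1}"

text \<open>The weak* topology is the topology of pointwise convergence on \<open>C\<close>.\<close>

definition gelfand_spectrum :: "'a::unital_cstar_algebra set \<Rightarrow> ('a \<Rightarrow> complex) topology" where
  "gelfand_spectrum C = subtopology (product_topology (\<lambda>_. euclidean) C) (characters C)"

lemma topspace_gelfand_spectrum [simp]: "topspace (gelfand_spectrum C) = characters C"
  by (auto simp: gelfand_spectrum_def characters_def PiE_def)


section \<open>Bundles over a poset\<close>

definition alexandroff :: "'p::order set \<Rightarrow> 'p topology" where
  "alexandroff P = topology (\<lambda>U. U \<subseteq> P \<and> (\<forall>p\<in>U. \<forall>q\<in>P. p \<le> q \<longrightarrow> q \<in> U))"

lemma openin_alexandroff:
  "openin (alexandroff P) U \<longleftrightarrow> U \<subseteq> P \<and> (\<forall>p\<in>U. \<forall>q\<in>P. p \<le> q \<longrightarrow> q \<in> U)"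
proof -
  have "istopology (\<lambda>U. U \<subseteq> P \<and> (\<forall>p\<in>U. \<forall>q\<in>P. p \<le> q \<longrightarrow> q \<in> U))"
    unfolding istopology_def by blast
  then show ?thesis by (simp add: alexandroff_def topology_inverse')
qed

lemma topspace_alexandroff [simp]: "topspace (alexandroff P) = P"
  by (auto simp: topspace_def openin_alexandroff)

text \<open>For a monotone assignment \<open>p \<mapsto> \<phi> p\<close> of subalgebras, the disjoint union over \<open>p \<in> P\<close> of
  the spectra of \<open>\<phi> p\<close>, with projection \<^const>\<open>fst\<close> to \<open>P\<close>. The choice \<open>\<phi> = id\<close> gives the spectral
  bundle of an algebra; a map \<open>\<phi>\<close> into its poset of subalgebras gives the pullback of that
  bundle along \<open>\<phi>\<close>, see \<open>pullback_of_spectral_bundle\<close> below.\<close>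

definition spectral_bundle ::
    "'p::order set \<Rightarrow> ('p \<Rightarrow> 'a::unital_cstar_algebra set) \<Rightarrow> ('p \<times> ('a \<Rightarrow> complex)) topology" where
  "spectral_bundle P \<phi> = topology (\<lambda>U.
     U \<subseteq> Sigma P (\<lambda>p. characters (\<phi> p)) \<and>
     (\<forall>p\<in>P. openin (gelfand_spectrum (\<phi> p)) {\<omega>. (p, \<omega>) \<in> U}) \<and>
     (\<forall>p\<in>P. \<forall>q\<in>P. p \<le> q \<longrightarrow>
        {\<omega> \<in> characters (\<phi> q). (p, restrict \<omega> (\<phi> p)) \<in> U} \<subseteq> {\<omega>. (q, \<omega>) \<in> U}))"

lemma openin_spectral_bundle:
  "openin (spectral_bundle P \<phi>) U \<longleftrightarrow>
     U \<subseteq> Sigma P (\<lambda>p. characters (\<phi> p)) \<and>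
     (\<forall>p\<in>P. openin (gelfand_spectrum (\<phi> p)) {\<omega>. (p, \<omega>) \<in> U}) \<and>
     (\<forall>p\<in>P. \<forall>q\<in>P. p \<le> q \<longrightarrow>
        {\<omega> \<in> characters (\<phi> q). (p, restrict \<omega> (\<phi> p)) \<in> U} \<subseteq> {\<omega>. (q, \<omega>) \<in> U})"
proof -
  define O1 where "O1 = (\<lambda>U. U \<subseteq> Sigma P (\<lambda>p. characters (\<phi> p)))"
  define O2 where "O2 = (\<lambda>U. \<forall>p\<in>P. openin (gelfand_spectrum (\<phi> p)) {\<omega>. (p, \<omega>) \<in> U})"
  define O3 where "O3 = (\<lambda>U. \<forall>p\<in>P. \<forall>q\<in>P. p \<le> q \<longrightarrow>
    {\<omega> \<in> characters (\<phi> q). (p, restrict \<omega> (\<phi> p)) \<in> U} \<subseteq> {\<omega>. (q, \<omega>) \<in> U})"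
  have Int: "{\<omega>. (p, \<omega>) \<in> S \<inter> T} = {\<omega>. (p, \<omega>) \<in> S} \<inter> {\<omega>. (p, \<omega>) \<in> T}" for p S T
    by blast
  have Un: "{\<omega>. (p, \<omega>) \<in> \<Union>\<K>} = \<Union>((\<lambda>K. {\<omega>. (p, \<omega>) \<in> K}) ` \<K>)" for p \<K>
    by auto
  have "O1 (S \<inter> T)" if "O1 S" "O1 T" for S T
    using that unfolding O1_def by blast
  moreover have "O1 (\<Union>\<K>)" if "\<forall>K\<in>\<K>. O1 K" for \<K>
    using that unfolding O1_def by (intro Union_least) simp
  moreover have "O2 (S \<inter> T)" if "O2 S" "O2 T" for S T
    using that unfolding O2_def Int by (simp add: openin_Int)
  moreover have "O2 (\<Union>\<K>)" if "\<forall>K\<in>\<K>. O2 K" for \<K>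
    using that unfolding O2_def Un by (auto intro!: openin_Union simp del: Union_iff)
  moreover have "O3 (S \<inter> T)" if "O3 S" "O3 T" for S T
    using that unfolding O3_def subset_iff Int_iff mem_Collect_eq by fast
  moreover have "O3 (\<Union>\<K>)" if "\<forall>K\<in>\<K>. O3 K" for \<K>
    using that unfolding O3_def subset_iff mem_Collect_eq by (meson UnionE UnionI)
  ultimately have "istopology (\<lambda>U. O1 U \<and> O2 U \<and> O3 U)"
    unfolding istopology_def by simp
  then show ?thesis
    unfolding spectral_bundle_def O1_def O2_def O3_def by (simp only: topology_inverse')
qed

lemma openin_spectral_bundleI:
  assumes "U \<subseteq> Sigma P (\<lambda>p. characters (\<phi> p))"
    and "\<And>p. p \<in> P \<Longrightarrow> openin (gelfand_spectrum (\<phi> p)) {\<omega>. (p, \<omega>) \<in> U}"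
    and "\<And>p q \<omega>. \<lbrakk>p \<in> P; q \<in> P; p \<le> q; \<omega> \<in> characters (\<phi> q);
           (p, restrict \<omega> (\<phi> p)) \<in> U\<rbrakk> \<Longrightarrow> (q, \<omega>) \<in> U"
  shows "openin (spectral_bundle P \<phi>) U"
  unfolding openin_spectral_bundle
  by (intro conjI ballI impI subsetI CollectI; (elim CollectE conjE)?) (fact | use assms(1) in blast)+

lemma openin_spectral_bundleD:
  assumes "openin (spectral_bundle P \<phi>) U"
  shows "(p, \<omega>) \<in> U \<Longrightarrow> p \<in> P \<and> \<omega> \<in> characters (\<phi> p)"
    and "p \<in> P \<Longrightarrow> openin (gelfand_spectrum (\<phi> p)) {\<omega>. (p, \<omega>) \<in> U}"
    and "\<lbrakk>p \<in> P; q \<in> P; p \<le> q; \<omega> \<in> characters (\<phi> q);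
           (p, restrict \<omega> (\<phi> p)) \<in> U\<rbrakk> \<Longrightarrow> (q, \<omega>) \<in> U"
  using assms unfolding openin_spectral_bundle by (fast | blast)+

lemma topspace_spectral_bundle:
  assumes "\<And>p q. \<lbrakk>p \<in> P; q \<in> P; p \<le> q\<rbrakk> \<Longrightarrow> \<phi> p \<subseteq> \<phi> q"
  shows "topspace (spectral_bundle P \<phi>) = Sigma P (\<lambda>p. characters (\<phi> p))"
proof
  have "openin (gelfand_spectrum (\<phi> p)) (characters (\<phi> p))" for p
    using openin_topspace[of "gelfand_spectrum (\<phi> p)"] by simp
  then have "openin (spectral_bundle P \<phi>) (Sigma P (\<lambda>p. characters (\<phi> p)))"
    unfolding openin_spectral_bundle by auto
  then show "Sigma P (\<lambda>p. characters (\<phi> p)) \<subseteq> topspace (spectral_bundle P \<phi>)"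
    by (rule openin_subset)
qed (use openin_spectral_bundle[of P \<phi>] in \<open>auto simp only: topspace_def\<close>)

lemma characters_restrict:
  assumes \<omega>: "\<omega> \<in> characters C" and sub: "D \<subseteq> C" and "1 \<in> D"
    and D: "\<And>x y. \<lbrakk>x \<in> D; y \<in> D\<rbrakk> \<Longrightarrow> x + y \<in> D" "\<And>x y. \<lbrakk>x \<in> D; y \<in> D\<rbrakk> \<Longrightarrow> x * y \<in> D"
      "\<And>c x. x \<in> D \<Longrightarrow> scaleC c x \<in> D"
  shows "restrict \<omega> D \<in> characters D"
proof -
  have "\<omega> (x + y) = \<omega> x + \<omega> y" "\<omega> (x * y) = \<omega> x * \<omega> y" if "x \<in> D" "y \<in> D" for x y
    using \<omega> sub that unfolding characters_def by blast+
  moreover have "\<omega> (scaleC c x) = c * \<omega> x" if "x \<in> D" for c x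
    using \<omega> sub that unfolding characters_def by blast
  moreover have "\<omega> 1 = 1"
    using \<omega> unfolding characters_def by blast
  ultimately show ?thesis
    using \<open>1 \<in> D\<close> D by (simp add: characters_def)
qed

lemma pullback_of_spectral_bundle:
  fixes P :: "'p::order set" and \<phi> :: "'p \<Rightarrow> 'a::unital_cstar_algebra set"
  assumes \<phi>: "\<And>p. p \<in> P \<Longrightarrow> \<phi> p \<in> comm_subalgebras"
    and mono: "\<And>p q. \<lbrakk>p \<in> P; q \<in> P; p \<le> q\<rbrakk> \<Longrightarrow> \<phi> p \<subseteq> \<phi> q"
  shows "homeomorphic_map
           (subtopology (prod_topology (alexandroff P) (spectral_bundle comm_subalgebras id))
              {(p, C, \<omega>). C = \<phi> p})
           (spectral_bundle P \<phi>) (\<lambda>(p, C, \<omega>). (p, \<omega>))"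
proof -
  define S :: "('a set \<times> ('a \<Rightarrow> complex)) topology" where "S = spectral_bundle comm_subalgebras id"
  define G :: "('p \<times> 'a set \<times> ('a \<Rightarrow> complex)) set" where "G = {(p, C, \<omega>). C = \<phi> p}"
  define Z where "Z = subtopology (prod_topology (alexandroff P) S) G"
  define B where "B = spectral_bundle P \<phi>"
  have topS: "topspace S = Sigma comm_subalgebras characters"
    unfolding S_def by (subst topspace_spectral_bundle) simp_all
  have topB: "topspace B = Sigma P (\<lambda>p. characters (\<phi> p))"
    unfolding B_def by (rule topspace_spectral_bundle) (rule mono)
  have topZ: "topspace Z = {(p, C, \<omega>). p \<in> P \<and> C = \<phi> p \<and> \<omega> \<in> characters C}"
    unfolding Z_def G_def using \<phi> by (auto simp: topS)
  have chars: "openin (gelfand_spectrum C) (characters C)" for C :: "'a set"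
    using openin_topspace[of "gelfand_spectrum C"] by simp
  have fst: "continuous_map B (alexandroff P) fst"
    unfolding continuous_map
  proof (intro conjI allI impI)
    fix U assume "openin (alexandroff P) U"
    then have U: "\<And>p q. \<lbrakk>p \<in> U; q \<in> P; p \<le> q\<rbrakk> \<Longrightarrow> q \<in> U"
      unfolding openin_alexandroff by simp
    show "openin B {x \<in> topspace B. fst x \<in> U}"
      unfolding B_def
    proof (rule openin_spectral_bundleI)
      fix p assume "p \<in> P"
      then have "{\<omega>. (p, \<omega>) \<in> {x \<in> topspace B. fst x \<in> U}} =
          (if p \<in> U then characters (\<phi> p) else {})"
        by (simp add: topB)
      then show "openin (gelfand_spectrum (\<phi> p))
          {\<omega>. (p, \<omega>) \<in> {x \<in> topspace (spectral_bundle P \<phi>). fst x \<in> U}}"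
        by (simp add: chars B_def)
    next
      fix p q \<omega> assume "p \<in> P" "q \<in> P" "p \<le> q" "\<omega> \<in> characters (\<phi> q)"
        "(p, restrict \<omega> (\<phi> p)) \<in> {x \<in> topspace (spectral_bundle P \<phi>). fst x \<in> U}"
      then show "(q, \<omega>) \<in> {x \<in> topspace (spectral_bundle P \<phi>). fst x \<in> U}"
        using U[of p q] by (simp add: topB[unfolded B_def])
    qed (use topB[unfolded B_def] in blast)
  qed (auto simp: topB)
  have snd: "continuous_map B S (\<lambda>x. (\<phi> (fst x), snd x))"
    unfolding continuous_map
  proof (intro conjI allI impI)
    fix U assume "openin S U"
    note U = openin_spectral_bundleD[OF this[unfolded S_def], unfolded id_apply]
    have mem: "(p, \<omega>) \<in> {x \<in> topspace B. (\<phi> (fst x), snd x) \<in> U} \<longleftrightarrow> p \<in> P \<and> (\<phi> p, \<omega>) \<in> U"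
      for p \<omega>
      using U(1)[of "\<phi> p" \<omega>] by (simp add: topB) blast
    show "openin B {x \<in> topspace B. (\<phi> (fst x), snd x) \<in> U}"
      unfolding B_def
    proof (rule openin_spectral_bundleI, unfold B_def[symmetric] mem)
      fix p assume "p \<in> P"
      then show "openin (gelfand_spectrum (\<phi> p)) {\<omega>. p \<in> P \<and> (\<phi> p, \<omega>) \<in> U}"
        using U(2)[OF \<phi>] by simp
    next
      fix p q \<omega> assume "p \<in> P" "q \<in> P" "p \<le> q" "\<omega> \<in> characters (\<phi> q)"
        "p \<in> P \<and> (\<phi> p, restrict \<omega> (\<phi> p)) \<in> U"
      then show "q \<in> P \<and> (\<phi> q, \<omega>) \<in> U"
        using U(3)[OF \<phi>[of p] \<phi>[of q] mono[of p q], of \<omega>] by blast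
    qed (use topB in blast)
  qed (use \<phi> in \<open>auto simp: topB topS\<close>)
  have 1: "continuous_map B Z (\<lambda>x. (fst x, \<phi> (fst x), snd x))"
    unfolding Z_def continuous_map_in_subtopology
    using continuous_map_pairedI[OF fst snd] by (auto simp: G_def)
  have restr: "continuous_map (gelfand_spectrum C) (gelfand_spectrum D) (\<lambda>\<nu>. restrict \<nu> D)"
    if C: "C \<in> comm_subalgebras" and D: "D \<in> comm_subalgebras" and sub: "D \<subseteq> C"
    for C D :: "'a set"
  proof -
    have "restrict \<nu> D \<in> characters D" if "\<nu> \<in> characters C" for \<nu>
      by (rule characters_restrict[OF that sub]) (use D in \<open>simp_all add: comm_subalgebras_def\<close>)
    moreover have "continuous_map (product_topology (\<lambda>_. euclidean) C)
        (product_topology (\<lambda>_. euclidean) D) (\<lambda>\<nu>::'a \<Rightarrow> complex. restrict \<nu> D)"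
      unfolding continuous_map_componentwise
      using sub by (auto intro!: continuous_map_product_projection)
    ultimately show ?thesis
      unfolding gelfand_spectrum_def
      by (auto simp: continuous_map_in_subtopology continuous_map_from_subtopology)
  qed
  have 2: "continuous_map Z B (\<lambda>(p, C, \<omega>). (p, \<omega>))"
    unfolding continuous_map
  proof (intro conjI allI impI)
    fix U assume "openin B U"
    note U = openin_spectral_bundleD[OF this[unfolded B_def]]
    let ?V = "{x \<in> topspace Z. (\<lambda>(p, C, \<omega>). (p, \<omega>)) x \<in> U}"
    have "\<exists>W. openin Z W \<and> z \<in> W \<and> W \<subseteq> ?V" if z: "z \<in> ?V" for z
    proof -
      obtain p \<omega> where z_eq: "z = (p, \<phi> p, \<omega>)" and p: "p \<in> P" and \<omega>: "(p, \<omega>) \<in> U"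
          "\<omega> \<in> characters (\<phi> p)"
        using z unfolding topZ by force
      define M where "M = {q \<in> P. p \<le> q}"
      define N where "N = {(C, \<nu>). C \<in> comm_subalgebras \<and> \<nu> \<in> characters C \<and> \<phi> p \<subseteq> C \<and>
          (p, restrict \<nu> (\<phi> p)) \<in> U}"
      have mem: "(C, \<nu>) \<in> N \<longleftrightarrow> C \<in> comm_subalgebras \<and> \<nu> \<in> characters C \<and> \<phi> p \<subseteq> C \<and>
          (p, restrict \<nu> (\<phi> p)) \<in> U" for C \<nu>
        by (simp add: N_def)
      have M: "openin (alexandroff P) M"
        unfolding openin_alexandroff M_def by (auto elim: order_trans)
      have N: "openin S N"
        unfolding S_def
      proof (rule openin_spectral_bundleI)
        fix C :: "'a set" assume C: "C \<in> comm_subalgebras"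
        show "openin (gelfand_spectrum (id C)) {\<nu>. (C, \<nu>) \<in> N}"
        proof (cases "\<phi> p \<subseteq> C")
          case True
          from openin_continuous_map_preimage[OF restr[OF C \<phi>[OF p] True] U(2)[OF p]]
          show ?thesis using C True by (simp add: mem)
        qed (simp add: mem)
      next
        fix C D :: "'a set" and \<nu>
        assume *: "C \<in> comm_subalgebras" "D \<in> comm_subalgebras" "C \<le> D" "\<nu> \<in> characters (id D)"
          "(C, restrict \<nu> (id C)) \<in> N"
        then have "\<phi> p \<subseteq> C" by (simp add: mem)
        moreover from this have "\<phi> p \<subseteq> D" using * by blast
        moreover from calculation have "restrict (restrict \<nu> C) (\<phi> p) = restrict \<nu> (\<phi> p)"
          by (simp add: inf_absorb2)
        ultimately show "(D, \<nu>) \<in> N" using * by (simp add: mem)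
      qed (auto simp: N_def)
      have "openin Z ((M \<times> N) \<inter> G)"
        unfolding Z_def openin_subtopology using M N by (metis openin_prod_Times_iff)
      moreover have "restrict \<omega> (\<phi> p) = \<omega>"
        using \<omega>(2) by (simp add: characters_def extensional_restrict)
      then have "z \<in> (M \<times> N) \<inter> G"
        using p \<omega> \<phi>[OF p] by (simp add: z_eq M_def mem G_def)
      moreover have "(M \<times> N) \<inter> G \<subseteq> ?V"
      proof
        fix x assume "x \<in> (M \<times> N) \<inter> G"
        then obtain q \<nu> where x: "x = (q, \<phi> q, \<nu>)" and q: "q \<in> P" "p \<le> q"
            and \<nu>: "\<nu> \<in> characters (\<phi> q)" "(p, restrict \<nu> (\<phi> p)) \<in> U"
          by (auto simp: M_def mem G_def)
        then show "x \<in> ?V" using U(3)[OF p q \<nu>] by (simp add: topZ)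
      qed
      ultimately show ?thesis by blast
    qed
    then show "openin Z ?V" by (subst openin_subopen) blast
  qed (auto simp: topZ topB)
  have "homeomorphic_maps Z B (\<lambda>(p, C, \<omega>). (p, \<omega>)) (\<lambda>x. (fst x, \<phi> (fst x), snd x))"
    unfolding homeomorphic_maps_def using 1 2 by (simp add: topZ topB)
  then have "homeomorphic_map Z B (\<lambda>(p, C, \<omega>). (p, \<omega>))"
    using homeomorphic_maps_map by blast
  then show ?thesis unfolding Z_def S_def G_def B_def .
qed

definition continuous_over ::
    "'x topology \<Rightarrow> 'e topology \<Rightarrow> ('e \<Rightarrow> 'x) \<Rightarrow> 'd topology \<Rightarrow> ('d \<Rightarrow> 'x) \<Rightarrow> ('e \<Rightarrow> 'd) \<Rightarrow> bool" where
  "continuous_over X E \<pi> E' \<pi>' h \<longleftrightarrow>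
     continuous_map E X \<pi> \<and> continuous_map E' X \<pi>' \<and> continuous_map E E' h \<and>
     (\<forall>e\<in>topspace E. \<pi>' (h e) = \<pi> e)"


section \<open>Locales internal to the topos of set-valued functors on a poset\<close>

text \<open>A functor from the poset \<open>stages\<close> to sets, with an internal order relation. The predicates
  below are the Kripke--Joyal readings of the usual notions of order theory, with \<open>p\<close> the stage
  at which they are forced.\<close>

record ('p, 'l) internal_poset =
  stages :: "'p set"
  sec :: "'p \<Rightarrow> 'l set"
  res :: "'p \<Rightarrow> 'p \<Rightarrow> 'l \<Rightarrow> 'l"
  leq :: "'p \<Rightarrow> 'l \<Rightarrow> 'l \<Rightarrow> bool"

definition above :: "('p::order, 'l, 'z) internal_poset_scheme \<Rightarrow> 'p \<Rightarrow> 'p set" where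
  "above L p = {q \<in> stages L. p \<le> q}"

definition is_internal_poset :: "('p::order, 'l, 'z) internal_poset_scheme \<Rightarrow> bool" where
  "is_internal_poset L \<longleftrightarrow>
     (\<forall>p\<in>stages L. \<forall>q\<in>above L p. \<forall>x\<in>sec L p. res L p q x \<in> sec L q) \<and>
     (\<forall>p\<in>stages L. \<forall>x\<in>sec L p. res L p p x = x) \<and>
     (\<forall>p\<in>stages L. \<forall>q\<in>above L p. \<forall>r\<in>above L q. \<forall>x\<in>sec L p.
        res L q r (res L p q x) = res L p r x) \<and>
     (\<forall>p\<in>stages L. \<forall>x\<in>sec L p. leq L p x x) \<and>
     (\<forall>p\<in>stages L. \<forall>x\<in>sec L p. \<forall>y\<in>sec L p. \<forall>z\<in>sec L p.
        leq L p x y \<and> leq L p y z \<longrightarrow> leq L p x z) \<and>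
     (\<forall>p\<in>stages L. \<forall>x\<in>sec L p. \<forall>y\<in>sec L p. leq L p x y \<and> leq L p y x \<longrightarrow> x = y) \<and>
     (\<forall>p\<in>stages L. \<forall>q\<in>above L p. \<forall>x\<in>sec L p. \<forall>y\<in>sec L p.
        leq L p x y \<longrightarrow> leq L q (res L p q x) (res L p q y))"

definition is_top :: "('p::order, 'l, 'z) internal_poset_scheme \<Rightarrow> 'p \<Rightarrow> 'l \<Rightarrow> bool" where
  "is_top L p t \<longleftrightarrow> t \<in> sec L p \<and> (\<forall>q\<in>above L p. \<forall>z\<in>sec L q. leq L q z (res L p q t))"

definition is_meet :: "('p::order, 'l, 'z) internal_poset_scheme \<Rightarrow> 'p \<Rightarrow> 'l \<Rightarrow> 'l \<Rightarrow> 'l \<Rightarrow> bool" where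
  "is_meet L p x y m \<longleftrightarrow> m \<in> sec L p \<and>
     (\<forall>q\<in>above L p. \<forall>z\<in>sec L q.
        leq L q z (res L p q m) \<longleftrightarrow> leq L q z (res L p q x) \<and> leq L q z (res L p q y))"

text \<open>Elements at stage \<open>p\<close> of the internal power object: subfunctors of the functor restricted
  to the stages above \<open>p\<close>.\<close>

definition is_internal_subset ::
    "('p::order, 'l, 'z) internal_poset_scheme \<Rightarrow> 'p \<Rightarrow> ('p \<Rightarrow> 'l set) \<Rightarrow> bool" where
  "is_internal_subset L p S \<longleftrightarrow>
     (\<forall>q\<in>above L p. S q \<subseteq> sec L q) \<and>
     (\<forall>q\<in>above L p. \<forall>r\<in>above L q. \<forall>x\<in>S q. res L q r x \<in> S r)"

definition is_join ::
    "('p::order, 'l, 'z) internal_poset_scheme \<Rightarrow> 'p \<Rightarrow> ('p \<Rightarrow> 'l set) \<Rightarrow> 'l \<Rightarrow> bool" where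
  "is_join L p S j \<longleftrightarrow> j \<in> sec L p \<and>
     (\<forall>q\<in>above L p. \<forall>z\<in>sec L q.
        leq L q (res L p q j) z \<longleftrightarrow> (\<forall>r\<in>above L q. \<forall>x\<in>S r. leq L r x (res L q r z)))"

definition is_internal_frame :: "('p::order, 'l, 'z) internal_poset_scheme \<Rightarrow> bool" where
  "is_internal_frame L \<longleftrightarrow> is_internal_poset L \<and>
     (\<forall>p\<in>stages L. \<exists>t. is_top L p t) \<and>
     (\<forall>p\<in>stages L. \<forall>x\<in>sec L p. \<forall>y\<in>sec L p. \<exists>m. is_meet L p x y m) \<and>
     (\<forall>p\<in>stages L. \<forall>S. is_internal_subset L p S \<longrightarrow> (\<exists>j. is_join L p S j)) \<and>
     (\<forall>p\<in>stages L. \<forall>S. is_internal_subset L p S \<longrightarrow>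
        (\<forall>x\<in>sec L p. \<forall>j m. is_join L p S j \<and> is_meet L p x j m \<longrightarrow>
           is_join L p (\<lambda>q. {n. \<exists>s\<in>S q. is_meet L q (res L p q x) s n}) m))"

definition is_internal_frame_hom ::
    "('p::order, 'l, 'z) internal_poset_scheme \<Rightarrow> ('p, 'm, 'y) internal_poset_scheme \<Rightarrow>
     ('p \<Rightarrow> 'l \<Rightarrow> 'm) \<Rightarrow> bool" where
  "is_internal_frame_hom L M h \<longleftrightarrow> stages L = stages M \<and>
     (\<forall>p\<in>stages L. \<forall>x\<in>sec L p. h p x \<in> sec M p) \<and>
     (\<forall>p\<in>stages L. \<forall>q\<in>above L p. \<forall>x\<in>sec L p. h q (res L p q x) = res M p q (h p x)) \<and>
     (\<forall>p\<in>stages L. \<forall>t. is_top L p t \<longrightarrow> is_top M p (h p t)) \<and>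
     (\<forall>p\<in>stages L. \<forall>x\<in>sec L p. \<forall>y\<in>sec L p. \<forall>m.
        is_meet L p x y m \<longrightarrow> is_meet M p (h p x) (h p y) (h p m)) \<and>
     (\<forall>p\<in>stages L. \<forall>S j. is_internal_subset L p S \<and> is_join L p S j \<longrightarrow>
        is_join M p (\<lambda>q. h q ` S q) (h p j))"

text \<open>A map of internal locales is an internal frame homomorphism in the opposite direction.\<close>

definition internal_locale_map ::
    "('p::order, 'm, 'y) internal_poset_scheme \<Rightarrow> ('p, 'l, 'z) internal_poset_scheme \<Rightarrow>
     ('p \<Rightarrow> 'l \<Rightarrow> 'm) \<Rightarrow> bool" where
  "internal_locale_map M L h \<longleftrightarrow>
     is_internal_frame M \<and> is_internal_frame L \<and> is_internal_frame_hom L M h"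

text \<open>The internal locale of a bundle \<open>\<pi> : E \<rightarrow> P\<close> has as frame the direct image along \<open>\<pi>\<close> of the
  frame of opens of \<open>E\<close>. As a sheaf on the Alexandroff space it is determined by its values on
  the least neighbourhoods \<open>{q. p \<le> q}\<close>, that is, by the functor sending \<open>p\<close> to the opens of
  the part of \<open>E\<close> above \<open>p\<close>.\<close>

definition internal_locale ::
    "'p::order set \<Rightarrow> 'e topology \<Rightarrow> ('e \<Rightarrow> 'p) \<Rightarrow> ('p, 'e set) internal_poset" where
  "internal_locale P E \<pi> =
     \<lparr>stages = P,
      sec = (\<lambda>p. {U. openin E U \<and> (\<forall>e\<in>U. p \<le> \<pi> e)}),
      res = (\<lambda>p q U. {e \<in> U. q \<le> \<pi> e}),
      leq = (\<lambda>p U V. U \<subseteq> V)\<rparr>"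

definition preimage_map :: "'e topology \<Rightarrow> ('e \<Rightarrow> 'd) \<Rightarrow> 'p \<Rightarrow> 'd set \<Rightarrow> 'e set" where
  "preimage_map E h = (\<lambda>p U. {e \<in> topspace E. h e \<in> U})"


section \<open>The bundles and maps induced by a homomorphism\<close>

abbreviation Sigma_up :: "('a::unital_cstar_algebra set \<times> ('a \<Rightarrow> complex)) topology" where
  "Sigma_up \<equiv> spectral_bundle comm_subalgebras id"

abbreviation F_sharp_Sigma ::
    "('a::unital_cstar_algebra \<Rightarrow> 'b::unital_cstar_algebra) \<Rightarrow> ('a set \<times> ('b \<Rightarrow> complex)) topology" where
  "F_sharp_Sigma f \<equiv> spectral_bundle comm_subalgebras (\<lambda>C. f ` C)"

abbreviation G_sharp_Sigma ::
    "('a::unital_cstar_algebra \<Rightarrow> 'b::unital_cstar_algebra) \<Rightarrow> ('b set \<times> ('a \<Rightarrow> complex)) topology" where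
  "G_sharp_Sigma f \<equiv> spectral_bundle comm_subalgebras (\<lambda>D. f -` D)"

definition Sigma_f ::
    "('a::unital_cstar_algebra \<Rightarrow> 'b::unital_cstar_algebra) \<Rightarrow>
     'a set \<times> ('b \<Rightarrow> complex) \<Rightarrow> 'a set \<times> ('a \<Rightarrow> complex)" where
  "Sigma_f f = (\<lambda>(C, \<omega>). (C, restrict (\<omega> \<circ> f) C))"

definition Sigma_g ::
    "('a::unital_cstar_algebra \<Rightarrow> 'b::unital_cstar_algebra) \<Rightarrow>
     'b set \<times> ('b \<Rightarrow> complex) \<Rightarrow> 'b set \<times> ('a \<Rightarrow> complex)" where
  "Sigma_g f = (\<lambda>(D, \<omega>). (D, restrict (\<omega> \<circ> f) (f -` D)))"

end

theory Submission
  imports Defs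
begin

text \<open>On the spectra, \<open>f\<close> acts by precomposition, which is weak* continuous and commutes with
  restriction to smaller subalgebras; this is all that continuity of the bundle maps needs.
  Internally, the Kripke--Joyal notions of top, meet and join in the frame of a bundle \<open>\<pi>\<close> reduce
  to the largest open above the stage, intersection, and union. For joins this
  uses that a point \<open>e\<close> of a member of an internal subset also lies in the restriction of that
  member to the stage \<open>\<pi> e\<close>. Preimage under a map of bundles preserves all three.\<close>

section \<open>The internal frame of a bundle\<close>

text \<open>Continuity of the projection makes the part of \<open>E\<close> above a stage open, so
  that restriction to later stages stays among the opens.\<close>

locale poset_bundle =
  fixes P :: "'p::order set" and E :: "'e topology" and \<pi> :: "'e \<Rightarrow> 'p"
  assumes continuous_proj: "continuous_map E (alexandroff P) \<pi>"
begin

abbreviation L where "L \<equiv> internal_locale P E \<pi>"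

lemma stages_L [simp]: "stages L = P"
  and sec_L: "U \<in> sec L p \<longleftrightarrow> openin E U \<and> (\<forall>e\<in>U. p \<le> \<pi> e)"
  and res_L [simp]: "res L p q U = {e \<in> U. q \<le> \<pi> e}"
  and leq_L [simp]: "leq L p U V \<longleftrightarrow> U \<subseteq> V"
  and above_L: "q \<in> above L p \<longleftrightarrow> q \<in> P \<and> p \<le> q"
  by (simp_all add: internal_locale_def above_def)

lemma proj_in: "e \<in> topspace E \<Longrightarrow> \<pi> e \<in> P"
  using continuous_map_funspace[OF continuous_proj] by auto

text \<open>Preimage of a principal up-set. This open is the top element at stage \<open>q\<close>,
  and restricting to \<open>q\<close> means intersecting with it.\<close>

lemma openin_above: "openin E {e \<in> topspace E. q \<le> \<pi> e}"
proof -
  have "openin (alexandroff P) {r \<in> P. q \<le> r}"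
    by (auto simp: openin_alexandroff)
  from openin_continuous_map_preimage[OF continuous_proj this]
  have "openin E {e \<in> topspace E. \<pi> e \<in> {r \<in> P. q \<le> r}}" .
  moreover have "{e \<in> topspace E. \<pi> e \<in> {r \<in> P. q \<le> r}} = {e \<in> topspace E. q \<le> \<pi> e}"
    using proj_in by auto
  ultimately show ?thesis by simp
qed

lemma sec_res:
  assumes "U \<in> sec L p" shows "{e \<in> U. q \<le> \<pi> e} \<in> sec L q"
proof -
  have "{e \<in> U. q \<le> \<pi> e} = U \<inter> {e \<in> topspace E. q \<le> \<pi> e}"
    using assms openin_subset[of E U] by (auto simp: sec_L)
  then show ?thesis using assms openin_above by (simp add: sec_L openin_Int)
qed

lemma sec_Int: "U \<in> sec L p \<Longrightarrow> V \<in> sec L p \<Longrightarrow> U \<inter> V \<in> sec L p"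
  by (simp add: sec_L openin_Int)

lemma res_self: "U \<in> sec L p \<Longrightarrow> {e \<in> U. p \<le> \<pi> e} = U"
  by (auto simp: sec_L)

lemma is_internal_poset_L: "is_internal_poset L"
  unfolding is_internal_poset_def
  by (intro conjI ballI impI; (simp add: sec_res res_self above_L)?) (blast intro: order_trans)+

section \<open>Tops, meets and joins as operations on opens\<close>

lemma is_top_iff:
  assumes p: "p \<in> P"
  shows "is_top L p t \<longleftrightarrow> t = {e \<in> topspace E. p \<le> \<pi> e}" (is "_ \<longleftrightarrow> t = ?T")
proof
  have T: "?T \<in> sec L p" by (simp add: sec_L openin_above)
  have "z \<subseteq> res L p q ?T" if "q \<in> above L p" "z \<in> sec L q" for q z
    using that openin_subset[of E z] by (force simp: above_L sec_L)
  with T show "is_top L p t" if "t = ?T"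
    unfolding is_top_def that leq_L by blast
  assume t: "is_top L p t"
  then have "t \<subseteq> ?T"
    by (auto simp: is_top_def sec_L dest: openin_subset)
  \<comment> \<open>The universal property is tested at stage \<open>p\<close> on \<open>?T\<close>
    itself.\<close>
  moreover have "?T \<subseteq> t"
    using t p T unfolding is_top_def by (fastforce simp: above_L)
  ultimately show "t = ?T" ..
qed

text \<open>Restriction only cuts down to points above \<open>q\<close>, so intersection has the
  universal property at every later stage. Conversely, stage \<open>p\<close>, where restriction is
  the identity, determines \<open>m\<close> by testing on \<open>m\<close> and on
  \<open>x \<inter> y\<close>.\<close>

lemma is_meet_iff:
  assumes p: "p \<in> P" and x: "x \<in> sec L p" and y: "y \<in> sec L p"
  shows "is_meet L p x y m \<longleftrightarrow> m = x \<inter> y"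
proof
  show "is_meet L p x y m" if "m = x \<inter> y"
    unfolding is_meet_def that using sec_Int[OF x y] by auto
  assume m: "is_meet L p x y m"
  then have sec: "m \<in> sec L p"
    by (simp add: is_meet_def)
  have univ: "z \<subseteq> m \<longleftrightarrow> z \<subseteq> x \<and> z \<subseteq> y" if "z \<in> sec L p" for z
  proof -
    have "z \<subseteq> res L p p m \<longleftrightarrow> z \<subseteq> res L p p x \<and> z \<subseteq> res L p p y"
      using m p that by (simp add: is_meet_def above_L)
    then show ?thesis unfolding res_L res_self[OF sec] res_self[OF x] res_self[OF y] .
  qed
  show "m = x \<inter> y"
    using univ[OF sec] univ[OF sec_Int[OF x y]] by auto
qed

lemma is_join_iff:
  assumes p: "p \<in> P" and S: "is_internal_subset L p S"
  shows "is_join L p S j \<longleftrightarrow> j = \<Union>(\<Union>q\<in>above L p. S q)" (is "_ \<longleftrightarrow> j = ?J")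
proof
  have Ssec: "x \<in> sec L q" if "q \<in> above L p" "x \<in> S q" for q x
    using S that unfolding is_internal_subset_def by blast
  have Sres: "{e \<in> x. r \<le> \<pi> e} \<in> S r" if "q \<in> above L p" "r \<in> above L q" "x \<in> S q" for q r x
    using S that unfolding is_internal_subset_def by simp
  have J: "?J \<in> sec L p"
    using Ssec by (auto simp: sec_L above_L) (meson order_trans)
  have univ: "{e \<in> ?J. q \<le> \<pi> e} \<subseteq> z \<longleftrightarrow> (\<forall>r\<in>above L q. \<forall>x\<in>S r. x \<subseteq> {e \<in> z. r \<le> \<pi> e})"
    if q: "q \<in> above L p" and z: "z \<in> sec L q" for q z
  proof (intro iffI ballI subsetI)
    fix r x e assume "{e \<in> ?J. q \<le> \<pi> e} \<subseteq> z" "r \<in> above L q" "x \<in> S r" "e \<in> x"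
    moreover from this have r: "r \<in> above L p" using q by (auto simp: above_L)
    moreover have "r \<le> \<pi> e" using Ssec[OF r] calculation by (auto simp: sec_L)
    moreover have "q \<le> \<pi> e" using calculation by (auto simp: above_L)
    ultimately show "e \<in> {e \<in> z. r \<le> \<pi> e}" by blast
  next
    \<comment> \<open>The stage \<open>r\<close> need not lie above \<open>q\<close>, so
      \<open>*\<close> may not apply to \<open>x\<close>. The stage \<open>\<pi> e\<close> lies
      above both, and the restriction of \<open>x\<close> to it still contains
      \<open>e\<close>.\<close>
    fix e assume *: "\<forall>r\<in>above L q. \<forall>x\<in>S r. x \<subseteq> {e \<in> z. r \<le> \<pi> e}" and "e \<in> {e \<in> ?J. q \<le> \<pi> e}"
    then obtain r x where r: "r \<in> above L p" and x: "x \<in> S r" and e: "e \<in> x" "q \<le> \<pi> e" by auto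
    have "e \<in> topspace E" "r \<le> \<pi> e"
      using Ssec[OF r x] e openin_subset by (auto simp: sec_L)
    then have "\<pi> e \<in> above L r" and q': "\<pi> e \<in> above L q"
      using e proj_in by (auto simp: above_L)
    from Sres[OF r this(1) x] have "{e' \<in> x. \<pi> e \<le> \<pi> e'} \<subseteq> z"
      using * q' by fastforce
    then show "e \<in> z" using e by auto
  qed
  show "is_join L p S j" if "j = ?J"
    unfolding is_join_def that res_L leq_L using J univ by (intro conjI ballI)
  assume j: "is_join L p S j"
  have pp: "p \<in> above L p" using p by (simp add: above_L)
  have sec: "j \<in> sec L p" using j by (simp add: is_join_def)
  \<comment> \<open>Both \<open>j\<close> and \<open>?J\<close> are sections at \<open>p\<close>
    with the same upper bounds there, so each lies below the other.\<close>
  have "j \<subseteq> z \<longleftrightarrow> ?J \<subseteq> z" if z: "z \<in> sec L p" for z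
  proof -
    have "{e \<in> j. p \<le> \<pi> e} \<subseteq> z \<longleftrightarrow> {e \<in> ?J. p \<le> \<pi> e} \<subseteq> z"
      unfolding univ[OF pp z] using j pp z by (simp add: is_join_def)
    then show ?thesis unfolding res_self[OF sec] res_self[OF J] .
  qed
  from this[OF sec] this[OF J] show "j = ?J" by blast
qed

text \<open>Existence of tops, meets and joins is read off from their characterizations. The frame
  law becomes distributivity of intersection over unions of sets.\<close>

lemma is_internal_frame_L: "is_internal_frame L"
  unfolding is_internal_frame_def
proof (intro conjI ballI allI impI; (elim conjE)?)
  fix p S x j m
  assume p: "p \<in> stages L" and S: "is_internal_subset L p S" and x: "x \<in> sec L p"
    and j: "is_join L p S j" and m: "is_meet L p x j m"
  let ?S = "\<lambda>q. {n. \<exists>s\<in>S q. is_meet L q (res L p q x) s n}"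
  have pP: "p \<in> P" using p by simp
  \<comment> \<open>Meets are unique, so the comprehension is a plain image of
    \<open>S q\<close>.\<close>
  have S_eq: "?S q = (\<inter>) {e \<in> x. q \<le> \<pi> e} ` S q" if "q \<in> above L p" for q
  proof -
    have "S q \<subseteq> sec L q" using S that by (simp add: is_internal_subset_def)
    then show ?thesis
      using that sec_res[OF x] by (auto simp: above_L is_meet_iff subset_iff image_iff)
  qed
  have Ssec: "s \<subseteq> {e. q \<le> \<pi> e}" if "q \<in> above L p" "s \<in> S q" for q s
    using S that by (fastforce simp: is_internal_subset_def sec_L)
  have "is_internal_subset L p ?S"
    unfolding is_internal_subset_def
  proof (intro conjI ballI)
    fix q assume q: "q \<in> above L p"
    have "S q \<subseteq> sec L q" using S q by (simp add: is_internal_subset_def)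
    then show "?S q \<subseteq> sec L q" unfolding S_eq[OF q] using sec_Int sec_res[OF x] by auto
    fix r n assume r: "r \<in> above L q" and "n \<in> ?S q"
    then obtain s where s: "s \<in> S q" "n = {e \<in> x. q \<le> \<pi> e} \<inter> s" unfolding S_eq[OF q] by blast
    have rp: "r \<in> above L p" using q r by (auto simp: above_L)
    have "{e \<in> s. r \<le> \<pi> e} \<in> S r" using S q r s by (simp add: is_internal_subset_def)
    moreover have "res L q r n = {e \<in> x. r \<le> \<pi> e} \<inter> {e \<in> s. r \<le> \<pi> e}"
      using r s by (auto simp: above_L)
    ultimately show "res L q r n \<in> ?S r" unfolding S_eq[OF rp] by blast
  qed
  moreover have "m = \<Union>(\<Union>q\<in>above L p. ?S q)"
  proof -
    have "m = x \<inter> j" using m j x pP is_meet_iff by (simp add: is_join_def)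
    \<comment> \<open>Members of \<open>S q\<close> lie above \<open>q\<close>, so meeting them with
      \<open>x\<close> or with its restriction to \<open>q\<close> is the same.\<close>
    also have "\<dots> = x \<inter> \<Union>(\<Union>q\<in>above L p. S q)" using j is_join_iff[OF pP S] by simp
    also have "\<dots> = \<Union>(\<Union>q\<in>above L p. (\<inter>) {e \<in> x. q \<le> \<pi> e} ` S q)"
      using Ssec by auto
    also have "\<dots> = \<Union>(\<Union>q\<in>above L p. ?S q)" using S_eq by simp
    finally show ?thesis .
  qed
  ultimately show "is_join L p ?S m" using is_join_iff[OF pP] by simp
qed (auto simp: is_internal_poset_L is_top_iff is_meet_iff is_join_iff)

end

section \<open>From continuous maps over the poset to internal locale maps\<close>

text \<open>Preimage preserves unions and intersections. Since \<open>h\<close> lies over the poset,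
  it also preserves tops and commutes with restriction.\<close>

lemma internal_locale_map_of_continuous_over:
  assumes "continuous_over (alexandroff P) E \<pi> E' \<pi>' h"
  shows "internal_locale_map (internal_locale P E \<pi>) (internal_locale P E' \<pi>') (preimage_map E h)"
proof -
  interpret M: poset_bundle P E \<pi>
    using assms by unfold_locales (simp add: continuous_over_def)
  interpret L: poset_bundle P E' \<pi>'
    using assms by unfold_locales (simp add: continuous_over_def)
  have h: "continuous_map E E' h" and \<pi>: "\<And>e. e \<in> topspace E \<Longrightarrow> \<pi>' (h e) = \<pi> e"
    using assms by (auto simp: continuous_over_def)
  have h_top: "\<And>e. e \<in> topspace E \<Longrightarrow> h e \<in> topspace E'"
    using continuous_map_funspace[OF h] by auto
  let ?h = "preimage_map E h"
  have sec: "?h p x \<in> sec M.L p" if "x \<in> sec L.L p" for p x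
    using that openin_continuous_map_preimage[OF h] \<pi>
    by (auto simp: L.sec_L M.sec_L preimage_map_def)
  have above: "above L.L = above M.L" by (auto simp: L.above_L M.above_L)
  have res: "?h q (res L.L p q x) = res M.L p q (?h p x)" for p q x
    using \<pi> by (auto simp: preimage_map_def)
  have "is_internal_frame_hom L.L M.L ?h"
    unfolding is_internal_frame_hom_def
  proof (intro conjI ballI allI impI; (elim conjE)?)
    fix p S j assume p: "p \<in> stages L.L" and S: "is_internal_subset L.L p S" and j: "is_join L.L p S j"
    \<comment> \<open>Needed to compute the join in \<open>M.L\<close> as a union; it holds because
      preimage commutes with restriction.\<close>
    have "is_internal_subset M.L p (\<lambda>q. ?h q ` S q)"
      unfolding is_internal_subset_def
    proof (intro conjI ballI)
      fix q assume q: "q \<in> above M.L p"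
      then show "?h q ` S q \<subseteq> sec M.L q"
        using S sec by (auto simp: is_internal_subset_def above)
      fix r y assume r: "r \<in> above M.L q" and "y \<in> ?h q ` S q"
      then obtain x where x: "x \<in> S q" "y = ?h q x" by blast
      have "res L.L q r x \<in> S r"
        using S q r x unfolding is_internal_subset_def above by blast
      then show "res M.L q r y \<in> ?h r ` S r"
        unfolding x(2) res[symmetric] by blast
    qed
    moreover have "j = \<Union>(\<Union>q\<in>above L.L p. S q)" using L.is_join_iff p S j by simp
    then have "?h p j = \<Union>(\<Union>q\<in>above M.L p. ?h q ` S q)"
      by (auto simp: preimage_map_def above)
    ultimately show "is_join M.L p (\<lambda>q. ?h q ` S q) (?h p j)"
      using M.is_join_iff p by simp
  next
    fix p t assume "p \<in> stages L.L" "is_top L.L p t"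
    then show "is_top M.L p (?h p t)"
      using h_top \<pi> by (auto simp: L.is_top_iff M.is_top_iff preimage_map_def)
  next
    fix p x y m assume "p \<in> stages L.L" "x \<in> sec L.L p" "y \<in> sec L.L p" "is_meet L.L p x y m"
    then show "is_meet M.L p (?h p x) (?h p y) (?h p m)"
      using sec by (auto simp: L.is_meet_iff M.is_meet_iff preimage_map_def)
  qed (simp_all add: sec res del: L.res_L M.res_L)
  then show ?thesis
    unfolding internal_locale_map_def using L.is_internal_frame_L M.is_internal_frame_L by blast
qed

section \<open>Maps of spectral bundles by precomposition\<close>

text \<open>The closure conditions to which the equations for a character refer. They pass to
  preimages under \<open>f\<close>.\<close>

definition unital_subalgebra :: "'a::unital_cstar_algebra set \<Rightarrow> bool" where
  "unital_subalgebra C \<longleftrightarrow> 1 \<in> C \<and> (\<forall>x\<in>C. \<forall>y\<in>C. x + y \<in> C) \<and>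
     (\<forall>c. \<forall>x\<in>C. scaleC c x \<in> C) \<and> (\<forall>x\<in>C. \<forall>y\<in>C. x * y \<in> C)"

lemma unital_subalgebra_comm: "C \<in> comm_subalgebras \<Longrightarrow> unital_subalgebra C"
  by (simp add: comm_subalgebras_def unital_subalgebra_def)

lemma unital_subalgebra_vimage:
  assumes "unital_star_hom f" "unital_subalgebra D"
  shows "unital_subalgebra (f -` D)"
  using assms by (simp add: unital_star_hom_def unital_subalgebra_def)

text \<open>An inclusion of the image of \<open>D\<close> in \<open>C\<close> covers both the image
  and the preimage assignment.\<close>

lemma characters_comp:
  assumes f: "unital_star_hom f" and D: "unital_subalgebra D" and sub: "f ` D \<subseteq> C"
    and \<omega>: "\<omega> \<in> characters C"
  shows "restrict (\<omega> \<circ> f) D \<in> characters D"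
proof -
  have "f x \<in> C" if "x \<in> D" for x using sub that by blast
  then show ?thesis
    using f D \<omega> by (simp add: characters_def unital_star_hom_def unital_subalgebra_def)
qed

text \<open>In the topology of pointwise convergence it suffices to evaluate at each
  \<open>x\<close> in \<open>D\<close>, which gives the coordinate projection at
  \<open>f x\<close>.\<close>

lemma continuous_map_gelfand_comp:
  assumes f: "unital_star_hom f" and D: "unital_subalgebra D" and sub: "f ` D \<subseteq> C"
  shows "continuous_map (gelfand_spectrum C) (gelfand_spectrum D) (\<lambda>\<omega>. restrict (\<omega> \<circ> f) D)"
proof -
  have "continuous_map (gelfand_spectrum C) euclidean (\<lambda>\<omega>. restrict (\<omega> \<circ> f) D x)"
    if "x \<in> D" for x
    using that sub unfolding gelfand_spectrum_def
    by (auto intro!: continuous_map_from_subtopology continuous_map_product_projection)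
  then show ?thesis
    unfolding gelfand_spectrum_def[of D]
    using characters_comp[OF f D sub]
    by (auto simp: continuous_map_in_subtopology continuous_map_componentwise)
qed

section \<open>Continuity on total spaces of spectral bundles\<close>

text \<open>Over each point the preimage of an up-set is the whole spectrum or empty, and upward
  closure gives the condition linking fibres.\<close>

lemma continuous_map_spectral_bundle_fst:
  assumes mono: "\<And>p q. \<lbrakk>p \<in> P; q \<in> P; p \<le> q\<rbrakk> \<Longrightarrow> \<phi> p \<subseteq> \<phi> q"
  shows "continuous_map (spectral_bundle P \<phi>) (alexandroff P) fst"
  unfolding continuous_map
proof (intro conjI allI impI)
  have top: "topspace (spectral_bundle P \<phi>) = Sigma P (\<lambda>p. characters (\<phi> p))"
    by (rule topspace_spectral_bundle) (rule mono)
  then show "fst ` topspace (spectral_bundle P \<phi>) \<subseteq> topspace (alexandroff P)" by auto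
  fix U assume U: "openin (alexandroff P) U"
  show "openin (spectral_bundle P \<phi>) {x \<in> topspace (spectral_bundle P \<phi>). fst x \<in> U}"
    unfolding top
  proof (rule openin_spectral_bundleI)
    fix p assume "p \<in> P"
    then have "{\<omega>. (p, \<omega>) \<in> {x \<in> Sigma P (\<lambda>p. characters (\<phi> p)). fst x \<in> U}} =
        (if p \<in> U then topspace (gelfand_spectrum (\<phi> p)) else {})" by simp
    then show "openin (gelfand_spectrum (\<phi> p))
        {\<omega>. (p, \<omega>) \<in> {x \<in> Sigma P (\<lambda>p. characters (\<phi> p)). fst x \<in> U}}"
      by (simp del: topspace_gelfand_spectrum)
  qed (use U in \<open>auto simp: openin_alexandroff\<close>)
qed

text \<open>Common form of both maps: \<open>\<phi>\<close> is the image assignment and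
  \<open>\<psi>\<close> the identity for \<open>Sigma_f\<close>; \<open>\<phi>\<close> is the
  identity and \<open>\<psi>\<close> the preimage assignment for \<open>Sigma_g\<close>.\<close>

lemma continuous_over_spectral_bundle_comp:
  fixes P :: "'p::order set"
  assumes f: "unital_star_hom f"
    and \<phi>: "\<And>p q. \<lbrakk>p \<in> P; q \<in> P; p \<le> q\<rbrakk> \<Longrightarrow> \<phi> p \<subseteq> \<phi> q"
    and \<psi>: "\<And>p q. \<lbrakk>p \<in> P; q \<in> P; p \<le> q\<rbrakk> \<Longrightarrow> \<psi> p \<subseteq> \<psi> q"
    and alg: "\<And>p. p \<in> P \<Longrightarrow> unital_subalgebra (\<psi> p)"
    and sub: "\<And>p. p \<in> P \<Longrightarrow> f ` \<psi> p \<subseteq> \<phi> p"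
  shows "continuous_over (alexandroff P) (spectral_bundle P \<phi>) fst (spectral_bundle P \<psi>) fst
           (\<lambda>(p, \<omega>). (p, restrict (\<omega> \<circ> f) (\<psi> p)))"
proof -
  let ?h = "\<lambda>(p, \<omega>). (p, restrict (\<omega> \<circ> f) (\<psi> p))"
  have top\<phi>: "topspace (spectral_bundle P \<phi>) = Sigma P (\<lambda>p. characters (\<phi> p))"
    by (rule topspace_spectral_bundle) (rule \<phi>)
  have top\<psi>: "topspace (spectral_bundle P \<psi>) = Sigma P (\<lambda>p. characters (\<psi> p))"
    by (rule topspace_spectral_bundle) (rule \<psi>)
  have "continuous_map (spectral_bundle P \<phi>) (spectral_bundle P \<psi>) ?h"
    unfolding continuous_map
  proof (intro conjI allI impI)
    show "?h ` topspace (spectral_bundle P \<phi>) \<subseteq> topspace (spectral_bundle P \<psi>)"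
      unfolding top\<phi> top\<psi> using characters_comp[OF f alg sub] by auto
    fix U assume U: "openin (spectral_bundle P \<psi>) U"
    note UD = openin_spectral_bundleD[OF U]
    show "openin (spectral_bundle P \<phi>) {x \<in> topspace (spectral_bundle P \<phi>). ?h x \<in> U}"
      unfolding top\<phi>
    proof (rule openin_spectral_bundleI)
      fix p assume p: "p \<in> P"
      from openin_continuous_map_preimage[OF continuous_map_gelfand_comp[OF f alg sub] UD(2)] p
      have "openin (gelfand_spectrum (\<phi> p))
          {\<omega> \<in> characters (\<phi> p). restrict (\<omega> \<circ> f) (\<psi> p) \<in> {\<omega>. (p, \<omega>) \<in> U}}"
        by simp
      then show "openin (gelfand_spectrum (\<phi> p))
          {\<omega>. (p, \<omega>) \<in> {x \<in> Sigma P (\<lambda>p. characters (\<phi> p)). ?h x \<in> U}}"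
        using p by simp
    next
      fix p q \<omega>
      assume p: "p \<in> P" and q: "q \<in> P" and le: "p \<le> q" and \<omega>: "\<omega> \<in> characters (\<phi> q)"
        and in_U: "(p, restrict \<omega> (\<phi> p)) \<in> {x \<in> Sigma P (\<lambda>p. characters (\<phi> p)). ?h x \<in> U}"
      \<comment> \<open>Naturality: precomposition with \<open>f\<close> commutes with restriction
        of characters. This carries the condition linking fibres from \<open>U\<close> to its
        preimage.\<close>
      have "restrict (restrict \<omega> (\<phi> p) \<circ> f) (\<psi> p) = restrict (restrict (\<omega> \<circ> f) (\<psi> q)) (\<psi> p)"
        using sub[OF p] \<psi>[OF p q le] by (auto simp: restrict_def fun_eq_iff)
      then have "(p, restrict (restrict (\<omega> \<circ> f) (\<psi> q)) (\<psi> p)) \<in> U"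
        using in_U by simp
      then have "(q, restrict (\<omega> \<circ> f) (\<psi> q)) \<in> U"
        by (rule UD(3)[OF p q le characters_comp[OF f alg[OF q] sub[OF q] \<omega>]])
      then show "(q, \<omega>) \<in> {x \<in> Sigma P (\<lambda>p. characters (\<phi> p)). ?h x \<in> U}"
        using q \<omega> by simp
    qed auto
  qed
  then show ?thesis
    unfolding continuous_over_def
    using continuous_map_spectral_bundle_fst[OF \<phi>] continuous_map_spectral_bundle_fst[OF \<psi>]
    by auto
qed

theorem proposition5p10:
  fixes f :: "'a::unital_cstar_algebra \<Rightarrow> 'b::unital_cstar_algebra"
  assumes "unital_star_hom f"
  shows
    "(continuous_over (alexandroff comm_subalgebras)
        (F_sharp_Sigma f) fst Sigma_up fst (Sigma_f f) \<and>
      internal_locale_map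
        (internal_locale comm_subalgebras (F_sharp_Sigma f) fst)
        (internal_locale comm_subalgebras Sigma_up fst)
        (preimage_map (F_sharp_Sigma f) (Sigma_f f))) \<and>
     (reflects_commutativity f \<longrightarrow>
      continuous_over (alexandroff comm_subalgebras)
        Sigma_up fst (G_sharp_Sigma f) fst (Sigma_g f) \<and>
      internal_locale_map
        (internal_locale comm_subalgebras Sigma_up fst)
        (internal_locale comm_subalgebras (G_sharp_Sigma f) fst)
        (preimage_map Sigma_up (Sigma_g f)))"
proof (intro conjI impI)
  show "continuous_over (alexandroff comm_subalgebras)
      (F_sharp_Sigma f) fst Sigma_up fst (Sigma_f f)"
    using continuous_over_spectral_bundle_comp[OF assms, of comm_subalgebras "\<lambda>C. f ` C" id]
    by (auto simp: Sigma_f_def unital_subalgebra_comm)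
  then show "internal_locale_map
      (internal_locale comm_subalgebras (F_sharp_Sigma f) fst)
      (internal_locale comm_subalgebras Sigma_up fst)
      (preimage_map (F_sharp_Sigma f) (Sigma_f f))"
    by (rule internal_locale_map_of_continuous_over)
  show "continuous_over (alexandroff comm_subalgebras)
      Sigma_up fst (G_sharp_Sigma f) fst (Sigma_g f)"
    \<comment> \<open>Here \<open>f\<close> maps the preimage of \<open>D\<close> into
      \<open>D\<close>, possibly properly.\<close>
    using continuous_over_spectral_bundle_comp[OF assms, of comm_subalgebras id "\<lambda>D. f -` D"]
    by (auto simp: Sigma_g_def unital_subalgebra_comm unital_subalgebra_vimage[OF assms])
  then show "internal_locale_map
      (internal_locale comm_subalgebras Sigma_up fst)
      (internal_locale comm_subalgebras (G_sharp_Sigma f) fst)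
      (preimage_map Sigma_up (Sigma_g f))"
    by (rule internal_locale_map_of_continuous_over)
qed

end
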